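(* For any graph $G$ with $n$ vertices, $$\frac{|A(G)|}{\binom{n}{2}}\le \alpha_n' = \frac{n^{2}}{(n-1)^{2}}\,\frac{(\beta_0-2)^2-2}{\beta_0(\beta_0-2)}\approx \frac{n^2}{(n-1)^2}\,0.55225694,$$ where $A(G)$ is the set of non-zero elements in the joint degree vector of $G$, $\alpha_n'$ is the maximum of the continuous relaxation, and $\beta_0$ is the unique solution $\beta>2$ of $\log(\beta-1)=\frac{\beta}{\beta-2}$ (numerically $\beta_0\approx 5.68050$).
   Context: Graphs are simple and without isolated vertices. For an $n$-vertex graph $G=(V,E)$ and $1\le i\le n-1$, let $V_i$ be the set of vertices of degree $i$. The joint degree vector (JDV) of $G$ is the vector of length $\binom n2$ with components $j_{ik}(G)=|\{xy\in E(G): x\in V_i,\ y\in V_k\}|$ for $1\le i\le k\le n-1$ (the number of edges joining a vertex of degree $i$ to a vertex of degree $k$). The set of non-zero elements of the JDV is $A(G)=\{(i,k): 1\le i\le k\le n-1,\ j_{ik}(G)\neq 0\}$. Continuous relaxation: $\alpha_n'$ is the maximum of $\frac{\mu(A')}{(n-1)^2}$, where $\mu$ denotes Lebesgue measure, among all subsets $A'\subseteq[1,n]\times[1,n]$ that are symmetric with respect to the line $y=x$ and satisfy $\iint_{A'}\frac1x\,dx\,dy\le n$. Here $\log$ is the natural logarithm.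
   Formalization: The equality of α_n' with the closed form is false for n = 2, 3, 4 (for n = 2 it would exceed 1); it is proved for n ≥ 5, and for n = 2, 3, 4 only "≤" is stated; the constant 0.55225694 is given to within 2·10⁻⁷. *)

theory Defs
  imports "HOL-Analysis.Analysis"
begin

(* An edge is the two-element set of its end vertices. *)
definition simple_graph :: "'a set \<Rightarrow> 'a set set \<Rightarrow> bool" where
  "simple_graph V E \<longleftrightarrow> finite V \<and> E \<subseteq> {{x, y} | x y. x \<in> V \<and> y \<in> V \<and> x \<noteq> y}"

definition no_isolated_vertices :: "'a set \<Rightarrow> 'a set set \<Rightarrow> bool" where
  "no_isolated_vertices V E \<longleftrightarrow> (\<forall>v\<in>V. \<exists>e\<in>E. v \<in> e)"

definition degree :: "'a set set \<Rightarrow> 'a \<Rightarrow> nat" where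
  "degree E v = card {e \<in> E. v \<in> e}"

definition degree_class :: "'a set \<Rightarrow> 'a set set \<Rightarrow> nat \<Rightarrow> 'a set" where
  "degree_class V E i = {v \<in> V. degree E v = i}"

definition jdv :: "'a set \<Rightarrow> 'a set set \<Rightarrow> nat \<Rightarrow> nat \<Rightarrow> nat" where
  "jdv V E i k = card {{x, y} | x y. {x, y} \<in> E \<and> x \<in> degree_class V E i \<and> y \<in> degree_class V E k}"

definition jdv_support :: "'a set \<Rightarrow> 'a set set \<Rightarrow> (nat \<times> nat) set" where
  "jdv_support V E = {(i, k). 1 \<le> i \<and> i \<le> k \<and> k \<le> card V - 1 \<and> jdv V E i k \<noteq> 0}"

(* The integrand is bounded on the square, so the Bochner integral below always exists
   and its default value 0 for non-integrable functions plays no role. *)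
definition relaxation_feasible :: "nat \<Rightarrow> (real \<times> real) set \<Rightarrow> bool" where
  "relaxation_feasible n A \<longleftrightarrow>
     A \<in> sets lebesgue \<and>
     A \<subseteq> {1..real n} \<times> {1..real n} \<and>
     prod.swap ` A = A \<and>
     (LINT p:A|lebesgue. 1 / fst p) \<le> real n"

definition relaxation_values :: "nat \<Rightarrow> real set" where
  "relaxation_values n = {measure lebesgue A / (real n - 1)\<^sup>2 | A. relaxation_feasible n A}"

(* Greatest is the maximum only if one exists; existence has to be established separately. *)
definition alpha_relax :: "nat \<Rightarrow> real" where
  "alpha_relax n = (GREATEST r. r \<in> relaxation_values n)"

definition beta0 :: real where
  "beta0 = (THE \<beta>. \<beta> > 2 \<and> ln (\<beta> - 1) = \<beta> / (\<beta> - 2))"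

end

theory Submission
  imports Defs
begin

text \<open>
Put \<open>w (x, y) = 1 / x + 1 / y\<close>. On a symmetric set the constraint \<open>\<integral>\<integral> 1 / x \<le> n\<close> says the same as
\<open>\<integral>\<integral> w \<le> 2 n\<close>, so the relaxation asks for the largest symmetric set with a bounded total cost. By the
bathtub principle (\<open>bathtub\<close>) such a problem is solved by filling up the cheapest points: a sublevel set
\<open>{w \<le> c}\<close> of total cost exactly \<open>2 n\<close> is optimal. Write \<open>c = \<beta> / n\<close>. As long as \<open>\<beta> - 1 \<le> n\<close>, the sublevel
set within \<open>(0, n]\<^sup>2\<close> stays inside \<open>[1, n]\<^sup>2\<close>; slicing it by vertical lines gives the cost condition
\<open>ln (\<beta> - 1) = \<beta> / (\<beta> - 2)\<close>, which is the equation for \<open>\<beta>\<^sub>0\<close>, and the area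
\<open>n\<^sup>2 ((\<beta> - 2)\<^sup>2 - 2) / (\<beta> (\<beta> - 2))\<close> (\<open>cheap_region_values\<close>). This settles \<open>n \<ge> 5\<close>. For smaller \<open>n\<close> the
same set sticks out of the square, so it gives an upper bound only (\<open>feasible_measure_le\<close>); a
maximum exists because the cost of \<open>{w \<le> c}\<close> is continuous in \<open>c\<close>, unless the whole square is
affordable and hence the maximum itself (\<open>square_feasible_or_tight_threshold\<close>).

On the graph side, give every edge the sum of the reciprocal degrees of its two ends. These weights
add up to at most \<open>n\<close>, since a vertex \<open>v\<close> receives \<open>1 / deg v\<close> from each of its \<open>deg v\<close> edges. Every
pair in the support of the joint degree vector is realised by an edge of its own, so the support \<open>S\<close>
satisfies \<open>\<Sum>\<^bsub>(i, k) \<in> S\<^esub> w (i, k) \<le> n\<close> (\<open>sum_endpoint_weights_le_card\<close>): a discrete form of the relaxed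
problem.

The discrete problem is compared with the continuous one through linear duality. With the optimal
\<open>c\<close> as multiplier and \<open>\<phi> = max 0 (c - w)\<close>, the bound on \<open>S\<close> is
\<open>2 c |S| \<le> 2 \<Sum>\<^bsub>i \<le> k\<^esub> \<phi> (i, k) + 2 n = \<Sum>\<^bsub>i, k\<^esub> \<phi> (i, k) + \<Sum>\<^bsub>i\<^esub> \<phi> (i, i) + 2 n\<close>.
As \<open>\<phi>\<close> increases in both variables, the sum over all lattice points is at most the integral of \<open>\<phi>\<close>
over the square, which is \<open>c \<mu> - 2 n\<close> for the area \<open>\<mu>\<close> of the optimal set
(\<open>lattice_sum_le_surplus\<close>). The diagonal counts double here, whereas it is a null set in the
relaxation; but the two sides are normalised by \<open>n (n - 1)\<close> and \<open>(n - 1)\<^sup>2\<close>, and the resulting factor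
\<open>n / (n - 1)\<close> leaves room for a diagonal sum of \<open>2 n / (n - 1)\<close>. That the diagonal fits into this room
is \<open>diagonal_beta0\<close> for \<open>n \<ge> 5\<close> and \<open>diagonal_small\<close> for \<open>n \<le> 4\<close>.
\<close>

section \<open>The critical constant\<close>

text \<open>
Since \<open>x / (x - 2) = 1 + 2 / (x - 2)\<close> decreases, the equation for \<open>\<beta>\<^sub>0\<close> has at most one solution, and
the sign of the difference of its sides tells on which side of \<open>\<beta>\<^sub>0\<close> a given number lies.
\<close>
lemma beta_equation_strict_mono:
  fixes x y :: real
  assumes "2 < x" "x < y"
  shows "ln (x - 1) - x / (x - 2) < ln (y - 1) - y / (y - 2)"
proof -
  have "x / (x - 2) = 1 + 2 / (x - 2)" "y / (y - 2) = 1 + 2 / (y - 2)"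
    using assms by (auto simp: field_simps)
  moreover have "2 / (y - 2) < 2 / (x - 2)"
    using assms by (intro divide_strict_left_mono) auto
  moreover have "ln (x - 1) < ln (y - 1)"
    using assms by simp
  ultimately show ?thesis by simp
qed

text \<open>
The limiting density is \<open>1 - 1 / x - 1 / (x - 2)\<close>; its monotonicity carries an enclosure of \<open>\<beta>\<^sub>0\<close> over
to the density.
\<close>
lemma density_strict_mono:
  fixes x y :: real
  assumes "2 < x" "x < y"
  shows "((x - 2)\<^sup>2 - 2) / (x * (x - 2)) < ((y - 2)\<^sup>2 - 2) / (y * (y - 2))"
proof -
  have eq: "((t - 2)\<^sup>2 - 2) / (t * (t - 2)) = 1 - 1 / t - 1 / (t - 2)" if "2 < t" for t :: real
    using that by (simp add: field_simps power2_eq_square)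
  have "1 / y < 1 / x" "1 / (y - 2) < 1 / (x - 2)"
    using assms by (auto intro!: divide_strict_left_mono)
  then show ?thesis
    using assms by (simp add: eq)
qed

lemma ln2_bounds: "ln (2::real) \<in> {0.69314715 .. 0.6931472}"
  using ln_approx_bounds[of 2 7] by (simp add: eval_nat_numeral field_simps)

text \<open>
Both numerical logarithms below have an argument close to \<open>4.68\<close>. Dividing it by 4 brings it close to
1, where three terms of the series for \<open>ln\<close> are accurate enough.
\<close>
lemma ln_times_4:
  fixes x :: real
  assumes "0 < x"
  shows "ln x + 1.3862943 \<le> ln (4 * x)" "ln (4 * x) \<le> ln x + 1.3862944"
proof -
  have "ln (4::real) = 2 * ln 2" using ln_realpow[of "2::real" 2] by simp
  moreover have "ln (4 * x) = ln 4 + ln x" using assms by (simp add: ln_mult_pos)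
  ultimately show "ln x + 1.3862943 \<le> ln (4 * x)" "ln (4 * x) \<le> ln x + 1.3862944"
    using ln2_bounds by auto
qed

text \<open>
The left end \<open>5.6804982\<close> lies only about \<open>4 \<cdot> 10\<^sup>-\<^sup>7\<close> below \<open>\<beta>\<^sub>0\<close>: the density grows by about \<open>0.105\<close> per
unit, and at \<open>\<beta>\<^sub>0\<close> it is already \<open>1.45 \<cdot> 10\<^sup>-\<^sup>7\<close> below the rounded value \<open>0.55225694\<close>, so an enclosure with
error \<open>5 \<cdot> 10\<^sup>-\<^sup>6\<close> would be too coarse for the stated tolerance.
\<close>
lemma beta_equation_below: "ln (5.6804982 - 1) < (5.6804982::real) / (5.6804982 - 2)"
proof -
  have "ln (1.17012455::real) \<le> 0.15711025"
    using ln_approx_bounds[of "1.17012455" 3] by (simp add: eval_nat_numeral field_simps)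
  then have "ln (4 * 1.17012455::real) \<le> 0.15711025 + 1.3862944"
    by (intro order_trans[OF ln_times_4(2)] add_right_mono) auto
  also have "\<dots> < 5.6804982 / (5.6804982 - 2)" by simp
  finally show ?thesis by simp
qed

lemma beta_equation_above: "ln (5.6805 - 1) > (5.6805::real) / (5.6805 - 2)"
proof -
  have "ln (1.170125::real) \<ge> 0.1571105"
    using ln_approx_bounds[of "1.170125" 3] by (simp add: eval_nat_numeral field_simps)
  then have "0.1571105 + 1.3862943 \<le> ln (4 * 1.170125::real)"
    by (intro order_trans[OF add_right_mono ln_times_4(1)]) auto
  moreover have "5.6805 / (5.6805 - 2) < (0.1571105 + 1.3862943 :: real)" by simp
  ultimately have "5.6805 / (5.6805 - 2) < ln (4 * 1.170125::real)" by (rule less_le_trans[rotated])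
  then show ?thesis by simp
qed

lemma beta_ex1: "\<exists>!\<beta>::real. \<beta> > 2 \<and> ln (\<beta> - 1) = \<beta> / (\<beta> - 2)"
proof -
  define h :: "real \<Rightarrow> real" where "h x = ln (x - 1) - x / (x - 2)" for x
  have root: "ln (x - 1) = x / (x - 2) \<longleftrightarrow> h x = 0" for x by (simp add: h_def)
  have mono: "h x < h y" if "2 < x" "x < y" for x y
    using beta_equation_strict_mono[OF that] by (simp only: h_def)
  have "h 5.6804982 \<le> 0" "0 \<le> h 5.6805" using beta_equation_below beta_equation_above unfolding h_def by linarith+
  moreover have "continuous_on {5.6804982..5.6805} h"
    unfolding h_def by (intro continuous_intros) auto
  ultimately obtain b where b: "5.6804982 \<le> b" "h b = 0"
    using IVT'[of h "5.6804982" 0 "5.6805"] by auto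
  then have "2 < b" by simp
  moreover have "x = b" if "2 < x" "h x = 0" for x
    using mono[of x b] mono[of b x] that b(2) \<open>2 < b\<close> by (metis less_irrefl linorder_neqE)
  ultimately show ?thesis unfolding root using b(2) by blast
qed

lemma beta0_solution: "beta0 > 2" "ln (beta0 - 1) = beta0 / (beta0 - 2)"
  using theI'[OF beta_ex1] by (auto simp: beta0_def)

lemma beta0_bounds: "5.6804982 < beta0" "beta0 < 5.6805"
proof -
  define h :: "real \<Rightarrow> real" where "h x = ln (x - 1) - x / (x - 2)" for x
  have less: "x < y" if "2 < x" "2 < y" "h x < h y" for x y
    using beta_equation_strict_mono[of y x] that by (cases x y rule: linorder_cases) (auto simp: h_def)
  have h0: "h beta0 = 0" using beta0_solution by (simp add: h_def)
  have "h 5.6804982 < h beta0" unfolding h0 using beta_equation_below unfolding h_def by linarith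
  then show "5.6804982 < beta0" by (rule less[rotated 2]) (simp_all add: beta0_solution(1))
  have "h beta0 < h 5.6805" unfolding h0 using beta_equation_above unfolding h_def by linarith
  then show "beta0 < 5.6805" by (rule less[rotated 2]) (simp_all add: beta0_solution(1))
qed

lemma density_bound: "\<bar>((beta0 - 2)\<^sup>2 - 2) / (beta0 * (beta0 - 2)) - 0.55225694\<bar> < 2 / 10 ^ 7"
proof -
  define g :: "real \<Rightarrow> real" where "g x = ((x - 2)\<^sup>2 - 2) / (x * (x - 2))" for x
  have "g 5.6804982 < g beta0"
    unfolding g_def by (rule density_strict_mono) (use beta0_bounds in auto)
  moreover have "g beta0 < g 5.6805"
    unfolding g_def using beta0_solution(1) beta0_bounds(2) by (rule density_strict_mono)
  moreover have "g 5.6804982 > 0.55225694 - 2 / 10 ^ 7" "g 5.6805 < 0.55225694 + 2 / 10 ^ 7"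
    by (simp_all add: g_def power2_eq_square)
  ultimately have "\<bar>g beta0 - 0.55225694\<bar> < 2 / 10 ^ 7" by linarith
  then show ?thesis by (simp only: g_def)
qed

lemma beta0_approx: "\<bar>beta0 - 5.68050\<bar> < 5 / 10 ^ 6" using beta0_bounds by simp

section \<open>Reciprocal degrees along the edges of a graph\<close>

text \<open>
Double counting of the incidences between vertices and edges, each weighted by the reciprocal degree
of its vertex. A pair \<open>(i, k)\<close> with \<open>i \<le> k\<close> is recovered from an edge realising it as the minimum and
maximum degree of the ends, so distinct pairs use distinct edges. For \<open>i = k\<close> both ends contribute,
which is why a diagonal pair costs \<open>2 / i\<close>.
\<close>
lemma sum_endpoint_weights_le_card:
  assumes G: "simple_graph V E"
  shows "(\<Sum>(i, k)\<in>jdv_support V E. 1 / real i + 1 / real k) \<le> real (card V)"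
proof -
  define d where "d = degree E"
  define ends where "ends e = (Min (d ` e), Max (d ` e))" for e
  have V: "finite V" and E: "E \<subseteq> {{x, y} | x y. x \<in> V \<and> y \<in> V \<and> x \<noteq> y}"
    using G by (auto simp: simple_graph_def)
  have "E \<subseteq> Pow V" using E by blast
  then have finE: "finite E" using V by (meson finite_Pow_iff finite_subset)
  have supp: "jdv_support V E \<subseteq> ends ` E"
  proof (clarify)
    fix i k assume "(i, k) \<in> jdv_support V E"
    then have ik: "i \<le> k" and "jdv V E i k \<noteq> 0" by (auto simp: jdv_support_def)
    then have "{{x, y} | x y. {x, y} \<in> E \<and> x \<in> degree_class V E i \<and> y \<in> degree_class V E k} \<noteq> {}"
      unfolding jdv_def by (metis card.empty)
    then obtain x y where xy: "{x, y} \<in> E" "d x = i" "d y = k"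
      by (auto simp: degree_class_def d_def)
    then have "ends {x, y} = (i, k)" using ik by (simp add: ends_def)
    then show "(i, k) \<in> ends ` E" using xy(1) by (metis imageI)
  qed
  have w: "(case ends e of (i, k) \<Rightarrow> 1 / real i + 1 / real k) = (\<Sum>v\<in>e. 1 / real (d v))" if "e \<in> E" for e
  proof -
    obtain x y where "e = {x, y}" "x \<noteq> y" using E \<open>e \<in> E\<close> by blast
    then show ?thesis by (simp add: ends_def min_def max_def)
  qed
  have "(\<Sum>(i, k)\<in>jdv_support V E. 1 / real i + 1 / real k)
      \<le> (\<Sum>(i, k)\<in>ends ` E. 1 / real i + 1 / real k)"
    using supp finE by (intro sum_mono2) auto
  also have "\<dots> \<le> (\<Sum>e\<in>E. case ends e of (i, k) \<Rightarrow> 1 / real i + 1 / real k)"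
    by (rule order_trans[OF sum_image_le]) (auto simp: finE split: prod.split)
  also have "\<dots> = (\<Sum>e\<in>E. \<Sum>v | v \<in> V \<and> v \<in> e. 1 / real (d v))"
  proof (intro sum.cong refl)
    fix e assume "e \<in> E"
    moreover have "{v. v \<in> V \<and> v \<in> e} = e" using \<open>E \<subseteq> Pow V\<close> \<open>e \<in> E\<close> by blast
    ultimately show "(case ends e of (i, k) \<Rightarrow> 1 / real i + 1 / real k)
        = (\<Sum>v | v \<in> V \<and> v \<in> e. 1 / real (d v))" by (simp add: w)
  qed
  also have "\<dots> = (\<Sum>v\<in>V. \<Sum>e | e \<in> E \<and> v \<in> e. 1 / real (d v))"
    using V finE by (rule sum.swap_restrict[rotated])
  also have "\<dots> = (\<Sum>v\<in>V. real (d v) * (1 / real (d v)))"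
    by (simp add: d_def degree_def)
  also have "\<dots> \<le> (\<Sum>v\<in>V. 1)"
    by (intro sum_mono) auto
  finally show ?thesis by simp
qed

section \<open>The bathtub principle and symmetric sets\<close>

text \<open>
The bathtub principle: a sublevel set of \<open>w\<close> is largest among the sets of no greater total weight.
Indeed \<open>B\<close> collects all points of \<open>A \<union> B\<close> at which \<open>c - w\<close> is positive, and none at which it is negative,
so \<open>\<integral>\<^sub>A (c - w) \<le> \<integral>\<^sub>B (c - w)\<close>.
\<close>
lemma bathtub:
  fixes w :: "'a \<Rightarrow> real"
  assumes A: "A \<in> fmeasurable M" "set_integrable M A w"
    and B: "B \<in> fmeasurable M" "set_integrable M B w"
    and c: "0 < c" "\<And>x. x \<in> B \<Longrightarrow> w x \<le> c" "\<And>x. x \<in> A \<Longrightarrow> w x \<le> c \<Longrightarrow> x \<in> B"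
    and le: "(LINT x:A|M. w x) \<le> (LINT x:B|M. w x)"
  shows "measure M A \<le> measure M B"
proof -
  have const: "set_integrable M X (\<lambda>_. c)" "(LINT x:X|M. c) = c * measure M X"
    if "X \<in> fmeasurable M" for X
    using that by (auto simp: set_integrable_def set_lebesgue_integral_def fmeasurable_def
        Int_absorb1[OF sets.sets_into_space])
  have "c * measure M A - (LINT x:A|M. w x) = (LINT x:A|M. c - w x)"
    using A const[OF A(1)] by (simp add: set_integral_diff)
  also have "\<dots> \<le> (LINT x:B|M. c - w x)"
    unfolding set_lebesgue_integral_def
  proof (rule integral_mono)
    show "integrable M (\<lambda>x. indicator A x *\<^sub>R (c - w x))"
      using set_integral_diff(1)[OF const(1)[OF A(1)] A(2)] by (simp add: set_integrable_def)
    show "integrable M (\<lambda>x. indicator B x *\<^sub>R (c - w x))"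
      using set_integral_diff(1)[OF const(1)[OF B(1)] B(2)] by (simp add: set_integrable_def)
    fix x
    show "indicator A x *\<^sub>R (c - w x) \<le> indicator B x *\<^sub>R (c - w x)"
      using c(2,3)[of x] by (cases "x \<in> A"; cases "x \<in> B") (auto simp: indicator_def, force)
  qed
  also have "\<dots> = c * measure M B - (LINT x:B|M. w x)"
    using B const[OF B(1)] by (simp add: set_integral_diff)
  finally have "c * measure M A \<le> c * measure M B" using le by linarith
  then show ?thesis using c(1) by simp
qed

lemma distr_lborel_swap: "distr lborel lborel prod.swap = (lborel :: (real \<times> real) measure)"
proof -
  have "(prod.swap :: real \<times> real \<Rightarrow> _) = (\<lambda>(x, y). (y, x))" by auto
  then show ?thesis
    using lborel_pair.distr_pair_swap[where 'a = real and 'b = real]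
    by (simp add: lborel_prod)
qed

text \<open>
Feasible sets are Lebesgue measurable only, so the invariance has to be lifted to the completion.
\<close>
lemma lebesgue_swap_invariant:
  "distr lebesgue lebesgue prod.swap = (lebesgue :: (real \<times> real) measure)"
proof -
  have meas: "prod.swap \<in> (lborel :: (real \<times> real) measure) \<rightarrow>\<^sub>M lborel"
    by (simp add: borel_measurable_continuous_onI continuous_on_swap)
  then have eq: "distr lebesgue lborel prod.swap = (lborel :: (real \<times> real) measure)"
    by (simp add: distr_completion distr_lborel_swap)
  have "completion (distr lebesgue lborel prod.swap) = distr lebesgue lebesgue (prod.swap :: real \<times> real \<Rightarrow> _)"
    using meas eq by (intro completion.completion_distr_eq) (auto intro: measurable_completion)
  then show ?thesis by (simp add: eq)
qed

lemma set_integral_swap: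
  fixes f :: "real \<times> real \<Rightarrow> real"
  assumes A: "A \<in> sets lebesgue" "prod.swap ` A = A" and f: "f \<in> borel_measurable borel"
  shows "(LINT p:A|lebesgue. f (prod.swap p)) = (LINT p:A|lebesgue. f p)"
proof -
  have meas: "(prod.swap :: real \<times> real \<Rightarrow> _) \<in> lebesgue \<rightarrow>\<^sub>M lebesgue"
  proof (rule completion.measurable_completion2)
    show "(prod.swap :: real \<times> real \<Rightarrow> _) \<in> lebesgue \<rightarrow>\<^sub>M lborel"
      by (intro measurable_completion) (simp add: borel_measurable_continuous_onI continuous_on_swap)
    then show "null_sets lborel \<subseteq> null_sets (distr lebesgue lborel (prod.swap :: real \<times> real \<Rightarrow> _))"
      using distr_lborel_swap by (simp add: distr_completion borel_measurable_continuous_onI continuous_on_swap)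
  qed
  have ind: "indicator A (prod.swap p) = (indicator A p :: real)" for p
  proof -
    have "prod.swap p \<in> A \<longleftrightarrow> p \<in> A" using A(2) by (metis image_eqI swap_swap)
    then show ?thesis by (simp add: indicator_def)
  qed
  have "(LINT p:A|lebesgue. f p) = (LINT p:A|distr lebesgue lebesgue prod.swap. f p)"
    by (simp add: lebesgue_swap_invariant)
  also have "\<dots> = (LINT p:A|lebesgue. f (prod.swap p))"
    unfolding set_lebesgue_integral_def
    using A(1) f meas
    by (subst integral_distr)
       (auto simp: ind measurable_completion intro!: borel_measurable_times borel_measurable_indicator)
  finally show ?thesis by simp
qed

definition endpoint_cost :: "real \<times> real \<Rightarrow> real" where
  "endpoint_cost p = 1 / fst p + 1 / snd p"

lemma endpoint_cost_measurable [measurable]: "endpoint_cost \<in> borel_measurable borel"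
  unfolding endpoint_cost_def by (simp add: borel_prod[symmetric])

lemma fst_inverse_measurable [measurable]: "(\<lambda>p :: real \<times> real. 1 / fst p) \<in> borel_measurable borel"
  by (simp add: borel_prod[symmetric])

lemma box_borel [measurable]: "{a..b} \<times> {c..d} \<in> sets (borel :: (real \<times> real) measure)"
  by (intro borel_closed closed_Times) auto

lemma box_lmeasurable: "{a..b} \<times> {c..d} \<in> (lmeasurable :: (real \<times> real) set set)"
  using lmeasurable_cbox[of "(a, c)" "(b, d)"] by (simp add: cbox_Pair_eq)

lemma set_integrable_reciprocals:
  fixes A :: "(real \<times> real) set"
  assumes A: "A \<in> sets lebesgue" "A \<subseteq> {a..b} \<times> {a..b}" and a: "0 < a"
  shows "set_integrable lebesgue A (\<lambda>p. 1 / fst p)" (is ?fst)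
    and "set_integrable lebesgue A (\<lambda>p. 1 / snd p)" (is ?snd)
proof -
  have A': "A \<in> lmeasurable" by (rule fmeasurableI2[OF box_lmeasurable A(2,1)])
  have bounded: "set_integrable lebesgue A f"
    if f: "f \<in> borel_measurable borel" "\<And>p. p \<in> A \<Longrightarrow> \<bar>f p\<bar> \<le> 1 / a" for f
  proof -
    have "integrable lebesgue (\<lambda>p. 1 / a * indicator A p)"
      using A' by (intro integrable_mult_right) (use A' in \<open>auto simp: fmeasurable_def intro!: integrable_real_indicator\<close>)
    then show ?thesis
      unfolding set_integrable_def
    proof (rule Bochner_Integration.integrable_bound)
      show "(\<lambda>p. indicat_real A p *\<^sub>R f p) \<in> borel_measurable lebesgue"
        using A(1) f(1) by (intro borel_measurable_scaleR borel_measurable_indicator measurable_completion) auto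
      show "AE p in lebesgue. norm (indicat_real A p *\<^sub>R f p) \<le> norm (1 / a * indicator A p)"
        using f(2) a by (intro AE_I2) (auto simp: indicator_def)
    qed
  qed
  show ?fst using A(2) a by (intro bounded) (auto simp: frac_le)
  have "(\<lambda>p. 1 / snd p) \<in> borel_measurable (borel :: (real \<times> real) measure)"
    by (simp add: borel_prod[symmetric])
  then show ?snd using A(2) a by (intro bounded) (auto simp: frac_le)
qed

text \<open>
Symmetrising the integrand: this turns the constraint into one on the symmetric function
\<open>endpoint_cost\<close>, whose sublevel sets are symmetric themselves.
\<close>
lemma symmetric_cost:
  fixes A :: "(real \<times> real) set"
  assumes A: "A \<in> sets lebesgue" "A \<subseteq> {a..b} \<times> {a..b}" "prod.swap ` A = A" and a: "0 < a"
  shows "set_integrable lebesgue A endpoint_cost"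
    and "(LINT p:A|lebesgue. endpoint_cost p) = 2 * (LINT p:A|lebesgue. 1 / fst p)"
proof -
  note int = set_integrable_reciprocals[OF A(1,2) a]
  have "(LINT p:A|lebesgue. 1 / snd p) = (LINT p:A|lebesgue. 1 / fst p)"
    using set_integral_swap[OF A(1,3), of "\<lambda>p. 1 / fst p"] by simp
  then show "(LINT p:A|lebesgue. endpoint_cost p) = 2 * (LINT p:A|lebesgue. 1 / fst p)"
    unfolding endpoint_cost_def using int by (simp add: set_integral_add)
  show "set_integrable lebesgue A endpoint_cost"
    unfolding endpoint_cost_def using int by (simp add: set_integral_add)
qed

section \<open>Threshold sets of the relaxation\<close>

definition square :: "nat \<Rightarrow> (real \<times> real) set" where
  "square n = {1..real n} \<times> {1..real n}"

definition threshold_region :: "nat \<Rightarrow> real \<Rightarrow> (real \<times> real) set" where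
  "threshold_region n c = {p \<in> square n. endpoint_cost p \<le> c}"

lemma square_borel [measurable]: "square n \<in> sets borel"
  unfolding square_def by (rule box_borel)

lemma threshold_region_borel [measurable]: "threshold_region n c \<in> sets borel"
  unfolding threshold_region_def by measurable

lemma measure_square: "1 \<le> n \<Longrightarrow> measure lebesgue (square n) = (real n - 1)\<^sup>2"
  using content_Pair[of "(1::real)" "1::real" "real n" "real n"]
  by (simp add: square_def cbox_Pair_eq power2_eq_square)

lemma feasible_iff:
  assumes "A \<in> sets lebesgue" "A \<subseteq> square n" "prod.swap ` A = A"
  shows "relaxation_feasible n A \<longleftrightarrow> (LINT p:A|lebesgue. endpoint_cost p) \<le> 2 * real n"
  using assms symmetric_cost(2)[OF assms(1) _ assms(3), of 1 "real n"]
  by (simp add: relaxation_feasible_def square_def)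

lemma relaxation_feasibleD:
  assumes "relaxation_feasible n A"
  shows "A \<in> lmeasurable" "A \<subseteq> square n" "set_integrable lebesgue A endpoint_cost"
    "(LINT p:A|lebesgue. endpoint_cost p) \<le> 2 * real n"
proof -
  have A: "A \<in> sets lebesgue" "A \<subseteq> square n" "prod.swap ` A = A"
    using assms by (auto simp: relaxation_feasible_def square_def)
  show "A \<in> lmeasurable" by (rule fmeasurableI2[OF box_lmeasurable A(2)[unfolded square_def] A(1)])
  show "A \<subseteq> square n" by (rule A)
  show "set_integrable lebesgue A endpoint_cost"
    using symmetric_cost(1)[OF A(1) _ A(3), of 1 "real n"] A(2) by (simp add: square_def)
  show "(LINT p:A|lebesgue. endpoint_cost p) \<le> 2 * real n"
    using feasible_iff[OF A] assms by simp
qed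

lemma square_properties:
  "square n \<in> lmeasurable" "square n \<in> sets lebesgue" "prod.swap ` square n = square n"
  "set_integrable lebesgue (square n) endpoint_cost"
proof -
  show "square n \<in> lmeasurable" unfolding square_def by (rule box_lmeasurable)
  then show s: "square n \<in> sets lebesgue" by auto
  show sw: "prod.swap ` square n = square n" by (auto simp: square_def image_iff)
  show "set_integrable lebesgue (square n) endpoint_cost"
    using symmetric_cost(1)[OF s _ sw, of 1 "real n"] by (simp add: square_def)
qed

lemma threshold_region_swap: "prod.swap ` threshold_region n c = threshold_region n c"
  by (auto simp: threshold_region_def square_def endpoint_cost_def image_iff)

lemma threshold_region_sets: "threshold_region n c \<in> sets lebesgue" "threshold_region n c \<subseteq> square n"
  by (auto simp: threshold_region_def sets_completionI_sets)

lemma tight_threshold_optimal: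
  assumes tight: "(LINT p:threshold_region n c|lebesgue. endpoint_cost p) = 2 * real n" and c: "0 < c"
  shows "relaxation_feasible n (threshold_region n c)"
    and "\<And>A. relaxation_feasible n A \<Longrightarrow> measure lebesgue A \<le> measure lebesgue (threshold_region n c)"
proof -
  show feas: "relaxation_feasible n (threshold_region n c)"
    using feasible_iff[OF threshold_region_sets threshold_region_swap] tight by simp
  fix A assume A: "relaxation_feasible n A"
  show "measure lebesgue A \<le> measure lebesgue (threshold_region n c)"
  proof (rule bathtub[where w = endpoint_cost and c = c])
    show "x \<in> threshold_region n c" if "x \<in> A" "endpoint_cost x \<le> c" for x
      using relaxation_feasibleD(2)[OF A] that by (auto simp: threshold_region_def)
    show "endpoint_cost x \<le> c" if "x \<in> threshold_region n c" for x
      using that by (simp add: threshold_region_def)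
    show "(LINT p:A|lebesgue. endpoint_cost p) \<le> (LINT p:threshold_region n c|lebesgue. endpoint_cost p)"
      using relaxation_feasibleD(4)[OF A] tight by simp
  qed (use A feas c relaxation_feasibleD in auto)
qed

text \<open>
Every vertical line meets a level curve in at most one point.
\<close>
lemma threshold_region_level_null:
  "AE p in lebesgue. p \<in> square n \<longrightarrow> endpoint_cost p \<noteq> c"
proof -
  define Z where "Z = {p \<in> square n. endpoint_cost p = c}"
  have Zb: "Z \<in> sets borel" unfolding Z_def by measurable
  have "emeasure lborel Z = (\<integral>\<^sup>+ x. emeasure lborel (Pair x -` Z) \<partial>lborel)"
    using Zb lborel.emeasure_pair_measure_alt[of Z lborel] by (simp only: lborel_prod sets_lborel)
  also have "\<dots> = 0"
  proof -
    have "Pair x -` Z \<subseteq> {1 / (c - 1 / x)}" for x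
      by (auto simp: Z_def square_def endpoint_cost_def)
    then have "emeasure lborel (Pair x -` Z) = 0" for x
      by (meson countable_finite countable_imp_null_set_lborel finite.emptyI finite.insertI finite_subset null_setsD1)
    then show ?thesis by simp
  qed
  finally have "Z \<in> null_sets lborel" using Zb by (simp add: null_sets_def)
  then have "AE p in lborel. p \<notin> Z" by (rule AE_not_in)
  then have "AE p in lebesgue. p \<notin> Z" by (rule AE_completion)
  then show ?thesis by (simp add: Z_def)
qed

text \<open>
Dominated convergence: along a convergent sequence of levels, membership of a point in the region is
eventually constant unless the point lies on the level set of the limit, which is null.
\<close>
lemma threshold_cost_continuous:
  "continuous_on UNIV (\<lambda>c. LINT p:threshold_region n c|lebesgue. endpoint_cost p)"
proof (subst continuous_on_sequentially, safe)
  fix x :: "nat \<Rightarrow> real" and a :: real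
  assume x: "x \<longlonglongrightarrow> a"
  have meas: "(\<lambda>p. indicator (threshold_region n c) p *\<^sub>R endpoint_cost p) \<in> borel_measurable lebesgue" for c
    by (intro borel_measurable_scaleR borel_measurable_indicator measurable_completion) auto
  have "(\<lambda>k. \<integral>p. indicator (threshold_region n (x k)) p *\<^sub>R endpoint_cost p \<partial>lebesgue)
      \<longlonglongrightarrow> (\<integral>p. indicator (threshold_region n a) p *\<^sub>R endpoint_cost p \<partial>lebesgue)"
  proof (rule integral_dominated_convergence[where w = "\<lambda>p. indicator (square n) p *\<^sub>R endpoint_cost p"])
    show "integrable lebesgue (\<lambda>p. indicat_real (square n) p *\<^sub>R endpoint_cost p)"
      using square_properties(4) by (simp add: set_integrable_def)
    show "AE p in lebesgue. norm (indicat_real (threshold_region n (x k)) p *\<^sub>R endpoint_cost p)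
        \<le> indicat_real (square n) p *\<^sub>R endpoint_cost p" for k
      by (intro AE_I2) (auto simp: indicator_def threshold_region_def square_def endpoint_cost_def)
    show "AE p in lebesgue. (\<lambda>k. indicat_real (threshold_region n (x k)) p *\<^sub>R endpoint_cost p)
        \<longlonglongrightarrow> indicat_real (threshold_region n a) p *\<^sub>R endpoint_cost p"
      using threshold_region_level_null[of n a]
    proof eventually_elim
      case (elim p)
      have "\<forall>\<^sub>F k in sequentially. (endpoint_cost p \<le> x k \<longleftrightarrow> endpoint_cost p \<le> a)" if "endpoint_cost p \<noteq> a"
      proof (cases "endpoint_cost p < a")
        case True
        then show ?thesis using order_tendstoD(1)[OF x True] by (auto elim!: eventually_mono)
      next
        case False
        then have "a < endpoint_cost p" using that by simp
        then show ?thesis using order_tendstoD(2)[OF x, of "endpoint_cost p"] by (auto elim!: eventually_mono)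
      qed
      then have "\<forall>\<^sub>F k in sequentially. indicat_real (threshold_region n (x k)) p *\<^sub>R endpoint_cost p
          = indicat_real (threshold_region n a) p *\<^sub>R endpoint_cost p"
        using elim by (cases "p \<in> square n") (auto simp: threshold_region_def indicator_def elim!: eventually_mono)
      then show ?case by (rule tendsto_eventually)
    qed
  qed (use meas in auto)
  then show "((\<lambda>c. LINT p:threshold_region n c|lebesgue. endpoint_cost p) \<circ> x)
      \<longlonglongrightarrow> (LINT p:threshold_region n a|lebesgue. endpoint_cost p)"
    by (simp add: set_lebesgue_integral_def o_def)
qed

text \<open>
The intermediate value theorem on \<open>[0, 2]\<close>: at level 0 the region is empty, at level 2 it is the whole
square.
\<close>
lemma square_feasible_or_tight_threshold:
  assumes n: "1 \<le> n"
  shows "relaxation_feasible n (square n) \<or>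
    (\<exists>c. 0 < c \<and> c \<le> 2 \<and> (LINT p:threshold_region n c|lebesgue. endpoint_cost p) = 2 * real n)"
proof (cases "relaxation_feasible n (square n)")
  case True
  then show ?thesis by simp
next
  case False
  define F where "F c = (LINT p:threshold_region n c|lebesgue. endpoint_cost p)" for c
  have "threshold_region n 2 = square n"
  proof -
    have "endpoint_cost p \<le> 2" if "p \<in> square n" for p
    proof -
      have "1 / fst p \<le> 1" "1 / snd p \<le> 1" using that by (auto simp: square_def)
      then show ?thesis by (simp add: endpoint_cost_def)
    qed
    then show ?thesis by (auto simp: threshold_region_def)
  qed
  then have F2: "2 * real n \<le> F 2"
    using False feasible_iff[OF square_properties(2) order_refl square_properties(3)] by (simp add: F_def)
  have "threshold_region n 0 = {}"
    by (auto simp: threshold_region_def square_def endpoint_cost_def add_nonneg_eq_0_iff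
        dest!: order.antisym[OF _ add_nonneg_nonneg])
  then have F0: "F 0 = 0" by (simp add: F_def set_lebesgue_integral_def)
  have "continuous_on {0..2} F"
    using threshold_cost_continuous[of n] unfolding F_def by (rule continuous_on_subset) auto
  then obtain c where c: "0 \<le> c" "c \<le> 2" "F c = 2 * real n"
    using IVT'[of F 0 "2 * real n" 2] F0 F2 by auto
  then have "c \<noteq> 0" using F0 n by auto
  then show ?thesis using c by (auto simp: F_def)
qed

section \<open>The explicit optimal region\<close>

text \<open>
The sublevel set of the cost in the scale-free square \<open>(0, N]\<^sup>2\<close>; the level is written as \<open>\<beta> / N\<close>
because \<open>(x, y) \<mapsto> (x / N, y / N)\<close> maps the region for \<open>N\<close> to that for 1 with the same \<open>\<beta>\<close>.
\<close>
definition cheap_region :: "real \<Rightarrow> real \<Rightarrow> (real \<times> real) set" where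
  "cheap_region N \<beta> = {p \<in> {0<..N} \<times> {0<..N}. endpoint_cost p \<le> \<beta> / N}"

lemma half_open_square_borel [measurable]: "{0<..N} \<times> {0<..N} \<in> sets (borel :: (real \<times> real) measure)"
  unfolding borel_prod[symmetric] by (intro pair_measureI) auto

lemma cheap_region_borel [measurable]: "cheap_region N \<beta> \<in> sets borel"
  unfolding cheap_region_def by measurable

text \<open>
Solving \<open>1 / x + 1 / y \<le> \<beta> / N\<close> for \<open>y\<close>. The left end \<open>N / (\<beta> - 1)\<close> is where the curve reaches \<open>y = N\<close>.
\<close>
lemma cheap_region_section:
  fixes x :: real
  assumes N: "0 < N" and \<beta>: "2 < \<beta>"
  shows "Pair x -` cheap_region N \<beta> =
    (if N / (\<beta> - 1) \<le> x \<and> x \<le> N then {N * x / (\<beta> * x - N)..N} else {})"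
proof -
  have iff: "1 / x + 1 / y \<le> \<beta> / N \<longleftrightarrow> N * (x + y) \<le> \<beta> * (x * y)" if "0 < x" "0 < y" for y
    using that N by (simp add: field_simps)
  have 1: "N / (\<beta> - 1) \<le> x" if "0 < x" "0 < y" "y \<le> N" "1 / x + 1 / y \<le> \<beta> / N" for y
  proof -
    have "1 / N \<le> 1 / y" using that by (simp add: frac_le)
    then have "1 / x \<le> (\<beta> - 1) / N" using that(4) by (simp add: diff_divide_distrib)
    then show ?thesis using that(1) N \<beta> by (simp add: field_simps)
  qed
  have 2: "0 < x \<and> 0 < \<beta> * x - N" if "N / (\<beta> - 1) \<le> x"
  proof -
    have x: "0 < x" using that N \<beta> by (meson divide_pos_pos less_le_trans diff_gt_0_iff_gt less_trans one_less_numeral_iff semiring_norm(76))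
    have "N \<le> (\<beta> - 1) * x" using that \<beta> by (simp add: field_simps)
    then show ?thesis using x by (simp add: algebra_simps)
  qed
  have 3: "N * x / (\<beta> * x - N) \<le> y \<longleftrightarrow> 0 < y \<and> 1 / x + 1 / y \<le> \<beta> / N" if "N / (\<beta> - 1) \<le> x" for y
  proof -
    note x = 2[OF that]
    have pos: "0 < N * x / (\<beta> * x - N)" using x N by simp
    have "N * x / (\<beta> * x - N) \<le> y \<longleftrightarrow> N * x \<le> y * (\<beta> * x - N)"
      using x by (simp add: pos_divide_le_eq)
    also have "\<dots> \<longleftrightarrow> N * (x + y) \<le> \<beta> * (x * y)" by (simp add: algebra_simps)
    finally have "N * x / (\<beta> * x - N) \<le> y \<longleftrightarrow> N * (x + y) \<le> \<beta> * (x * y)" .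
    then show ?thesis using iff[of y] x pos by (cases "0 < y") auto
  qed
  have mem: "y \<in> Pair x -` cheap_region N \<beta> \<longleftrightarrow>
      0 < x \<and> x \<le> N \<and> 0 < y \<and> y \<le> N \<and> 1 / x + 1 / y \<le> \<beta> / N" for y
    by (simp add: cheap_region_def endpoint_cost_def)
  show ?thesis
  proof (cases "N / (\<beta> - 1) \<le> x")
    case True
    have "y \<in> Pair x -` cheap_region N \<beta> \<longleftrightarrow> x \<le> N \<and> N * x / (\<beta> * x - N) \<le> y \<and> y \<le> N" for y
      unfolding mem using 2[OF True] 3[OF True, of y] by blast
    then show ?thesis using True by (intro set_eqI) simp
  next
    case False
    then have "Pair x -` cheap_region N \<beta> = {}" using 1 mem by blast
    then show ?thesis using False by simp
  qed
qed

text \<open>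
Tonelli's theorem together with the fundamental theorem of calculus, for an integrand that depends on
the first coordinate only.
\<close>
lemma cheap_region_integral:
  fixes f F :: "real \<Rightarrow> real"
  assumes N: "0 < N" and \<beta>: "2 < \<beta>"
    and f: "f \<in> borel_measurable borel" "\<And>x. 0 < x \<Longrightarrow> 0 \<le> f x"
    and F: "\<And>x. N / (\<beta> - 1) \<le> x \<Longrightarrow> (F has_real_derivative f x * (N - N * x / (\<beta> * x - N))) (at x)"
  shows "has_bochner_integral lborel (\<lambda>p. indicator (cheap_region N \<beta>) p * f (fst p)) (F N - F (N / (\<beta> - 1)))"
proof -
  define a where "a = N / (\<beta> - 1)"
  define h where "h x = N - N * x / (\<beta> * x - N)" for x
  have a: "0 < a" "a \<le> N" using N \<beta> by (auto simp: a_def field_simps)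
  have h: "0 \<le> h x" "emeasure lborel {N * x / (\<beta> * x - N)..N} = ennreal (h x)" if "a \<le> x" "x \<le> N" for x
  proof -
    have 1: "N \<le> (\<beta> - 1) * x" using that \<beta> by (simp add: a_def field_simps)
    then have "N * x \<le> N * (\<beta> * x - N)" using N by (intro mult_left_mono) (auto simp: algebra_simps)
    moreover have "0 < \<beta> * x - N" using 1 that a by (simp add: algebra_simps)
    ultimately have "N * x / (\<beta> * x - N) \<le> N" by (simp add: pos_divide_le_eq)
    then show "0 \<le> h x" "emeasure lborel {N * x / (\<beta> * x - N)..N} = ennreal (h x)"
      by (auto simp: h_def)
  qed
  have hm: "h \<in> borel_measurable borel" unfolding h_def by measurable
  have fm: "f \<in> borel_measurable borel" by (rule f)
  have nonneg: "0 \<le> f x * h x" if "x \<in> {a..N}" for x using that h f(2)[of x] a by auto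
  have R: "cheap_region N \<beta> \<in> sets (lborel \<Otimes>\<^sub>M lborel)" by (simp only: lborel_prod sets_lborel cheap_region_borel)
  have "(\<integral>\<^sup>+ p. ennreal (indicator (cheap_region N \<beta>) p * f (fst p)) \<partial>lborel)
     = (\<integral>\<^sup>+ p. ennreal (f (fst p)) * indicator (cheap_region N \<beta>) p \<partial>(lborel \<Otimes>\<^sub>M lborel))"
    by (auto simp: lborel_prod indicator_def intro!: nn_integral_cong)
  also have "\<dots> = (\<integral>\<^sup>+ x. \<integral>\<^sup>+ y. ennreal (f x) * indicator (cheap_region N \<beta>) (x, y) \<partial>lborel \<partial>lborel)"
    using R fm by (subst lborel.nn_integral_fst[symmetric])
      (auto intro!: borel_measurable_times borel_measurable_indicator measurable_compose[OF _ fm, THEN measurable_compose])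
  also have "\<dots> = (\<integral>\<^sup>+ x. ennreal (f x * h x) * indicator {a..N} x \<partial>lborel)"
  proof (intro nn_integral_cong)
    fix x
    have "(\<integral>\<^sup>+ y. ennreal (f x) * indicator (cheap_region N \<beta>) (x, y) \<partial>lborel)
        = (\<integral>\<^sup>+ y. ennreal (f x) * indicator (Pair x -` cheap_region N \<beta>) y \<partial>lborel)"
      by (auto simp: indicator_def intro!: nn_integral_cong)
    also have "\<dots> = ennreal (f x) * emeasure lborel (Pair x -` cheap_region N \<beta>)"
      by (simp add: cheap_region_section[OF N \<beta>] nn_integral_cmult)
    also have "\<dots> = ennreal (f x * h x) * indicator {a..N} x"
      unfolding cheap_region_section[OF N \<beta>] a_def[symmetric]
      using h f(2)[of x] a by (auto simp: ennreal_mult)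
    finally show "(\<integral>\<^sup>+ y. ennreal (f x) * indicator (cheap_region N \<beta>) (x, y) \<partial>lborel)
        = ennreal (f x * h x) * indicator {a..N} x" .
  qed
  also have "\<dots> = ennreal (F N - F a)"
    using hm fm nonneg a F by (intro nn_integral_FTC_Icc) (auto simp: h_def a_def)
  finally have nn: "(\<integral>\<^sup>+ p. ennreal (indicator (cheap_region N \<beta>) p * f (fst p)) \<partial>lborel) = ennreal (F N - F a)" .
  have "F a \<le> F N"
    using a F nonneg by (intro DERIV_nonneg_imp_nondecreasing[of a N F]) (auto simp: h_def a_def)
  moreover have "indicator (cheap_region N \<beta>) p * f (fst p) \<ge> 0" for p
    using f(2)[of "fst p"] by (auto simp: indicator_def cheap_region_def)
  moreover have "(\<lambda>p. indicator (cheap_region N \<beta>) p * f (fst p)) \<in> borel_measurable lborel"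
    unfolding lborel_prod[symmetric]
    using R by (intro borel_measurable_times borel_measurable_indicator measurable_compose[OF measurable_fst])
      (simp_all add: fm)
  ultimately show ?thesis
    using nn unfolding a_def by (intro has_bochner_integral_nn_integral) auto
qed

text \<open>
For a general \<open>\<beta>\<close> the integral of \<open>1 / x\<close> over the region is \<open>N ln (\<beta> - 1) (\<beta> - 2) / \<beta>\<close>; the equation
for \<open>\<beta>\<^sub>0\<close> is exactly the condition that this equals \<open>N\<close>.
\<close>
lemma cheap_region_values:
  assumes N: "0 < N" and \<beta>: "2 < \<beta>" and eq: "ln (\<beta> - 1) = \<beta> / (\<beta> - 2)"
  shows "has_bochner_integral lborel (\<lambda>p. indicator (cheap_region N \<beta>) p * 1)
           (N\<^sup>2 * (((\<beta> - 2)\<^sup>2 - 2) / (\<beta> * (\<beta> - 2))))" (is ?area)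
    and "has_bochner_integral lborel (\<lambda>p. indicator (cheap_region N \<beta>) p * (1 / fst p)) N" (is ?cost)
proof -
  define a where "a = N / (\<beta> - 1)"
  define K where "K = N / \<beta>\<^sup>2"
  \<comment> \<open>Antiderivatives of the section length and of the section length divided by \<open>x\<close>, from \<open>x / (\<beta> x - N) = 1 / \<beta> + (N / \<beta>) / (\<beta> x - N)\<close>.\<close>
  define F1 where "F1 x = N * x - N * (x / \<beta> + K * ln (\<beta> * x - N))" for x
  define F2 where "F2 x = N * ln x - N / \<beta> * ln (\<beta> * x - N)" for x
  have pos: "0 < x" "0 < \<beta> * x - N" if "a \<le> x" for x
  proof -
    have "0 < a" using N \<beta> by (simp add: a_def)
    then show "0 < x" using that by simp
    have "N \<le> (\<beta> - 1) * x" using that \<beta> by (simp add: a_def field_simps)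
    then show "0 < \<beta> * x - N" using \<open>0 < x\<close> by (simp add: algebra_simps)
  qed
  have D1: "(F1 has_real_derivative 1 * (N - N * x / (\<beta> * x - N))) (at x)" if "a \<le> x" for x
  proof -
    have "(F1 has_real_derivative N - N * (1 / \<beta> + K * (\<beta> / (\<beta> * x - N)))) (at x)"
      unfolding F1_def using pos[OF that] \<beta> by (auto intro!: derivative_eq_intros)
    moreover have "1 / \<beta> + K * (\<beta> / (\<beta> * x - N)) = x / (\<beta> * x - N)"
    proof -
      have "K * (\<beta> / (\<beta> * x - N)) = N / (\<beta> * (\<beta> * x - N))"
        using \<beta> by (simp add: K_def power2_eq_square)
      moreover have "1 / \<beta> + N / (\<beta> * D) = (\<beta> * x) / (\<beta> * D)" if "\<beta> * x = D + N" "0 < D" for D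
        unfolding that(1) using that(2) \<beta> by (simp add: add_divide_distrib)
      ultimately show ?thesis using pos[OF that] \<beta> by simp
    qed
    ultimately show ?thesis by simp
  qed
  have D2: "(F2 has_real_derivative 1 / x * (N - N * x / (\<beta> * x - N))) (at x)" if "a \<le> x" for x
  proof -
    have "(F2 has_real_derivative N * (1 / x) - N / \<beta> * (\<beta> / (\<beta> * x - N))) (at x)"
      unfolding F2_def using pos[OF that] \<beta> by (auto intro!: derivative_eq_intros)
    moreover have "N * (1 / x) - N / \<beta> * (\<beta> / (\<beta> * x - N)) = 1 / x * (N - N * x / (\<beta> * x - N))"
      using pos[OF that] \<beta> by (simp add: field_simps)
    ultimately show ?thesis by simp
  qed
  have ends: "\<beta> * N - N = N * (\<beta> - 1)" "\<beta> * a - N = N / (\<beta> - 1)"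
    using \<beta> by (simp_all add: a_def field_simps)
  have l: "ln (N * (\<beta> - 1)) = ln N + ln (\<beta> - 1)" "ln (N / (\<beta> - 1)) = ln N - ln (\<beta> - 1)"
    using N \<beta> by (auto simp: ln_mult_pos ln_div)
  have "F1 N - F1 a = N * (N - a) * (1 - 1 / \<beta>) - N\<^sup>2 / \<beta>\<^sup>2 * (2 * ln (\<beta> - 1))"
    unfolding F1_def K_def ends l using \<beta> by (simp add: field_simps power2_eq_square)
  also have "N - a = N * (\<beta> - 2) / (\<beta> - 1)" using \<beta> by (simp add: a_def field_simps)
  also have "N * (N * (\<beta> - 2) / (\<beta> - 1)) * (1 - 1 / \<beta>) = N\<^sup>2 * ((\<beta> - 2) / \<beta>)"
    using \<beta> by (simp add: field_simps power2_eq_square)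
  also have "N\<^sup>2 * ((\<beta> - 2) / \<beta>) - N\<^sup>2 / \<beta>\<^sup>2 * (2 * ln (\<beta> - 1)) = N\<^sup>2 * (((\<beta> - 2)\<^sup>2 - 2) / (\<beta> * (\<beta> - 2)))"
    unfolding eq using \<beta> by (simp add: field_simps power2_eq_square)
  finally have v1: "F1 N - F1 a = N\<^sup>2 * (((\<beta> - 2)\<^sup>2 - 2) / (\<beta> * (\<beta> - 2)))" .
  have "F2 N - F2 a = N * ln (\<beta> - 1) * ((\<beta> - 2) / \<beta>)"
    unfolding F2_def ends l l(2)[folded a_def] using \<beta> by (simp add: field_simps)
  also have "\<dots> = N" unfolding eq using \<beta> by simp
  finally have v2: "F2 N - F2 a = N" .
  show ?area using cheap_region_integral[of N \<beta> "\<lambda>_. 1" F1, OF N \<beta> _ _ D1] v1 by (simp add: a_def)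
  show ?cost using cheap_region_integral[of N \<beta> "\<lambda>x. 1 / x" F2, OF N \<beta> _ _ D2] v2 by (simp add: a_def)
qed

lemma cheap_region_swap: "prod.swap ` cheap_region N \<beta> = cheap_region N \<beta>"
  by (auto simp: cheap_region_def endpoint_cost_def image_iff)

lemma cheap_region_subset:
  assumes "0 < N" "2 < \<beta>"
  shows "cheap_region N \<beta> \<subseteq> {N / (\<beta> - 1)..N} \<times> {N / (\<beta> - 1)..N}"
proof -
  have fst: "N / (\<beta> - 1) \<le> fst p \<and> fst p \<le> N" if "p \<in> cheap_region N \<beta>" for p
  proof -
    have "snd p \<in> Pair (fst p) -` cheap_region N \<beta>" using that by simp
    then show ?thesis unfolding cheap_region_section[OF assms] by (auto split: if_splits)
  qed
  have "prod.swap p \<in> cheap_region N \<beta>" if "p \<in> cheap_region N \<beta>" for p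
    using that cheap_region_swap by blast
  then show ?thesis using fst by (fastforce simp: mem_Times_iff)
qed

lemma cheap_region_sets: "cheap_region N \<beta> \<in> sets lebesgue"
  by (simp add: sets_completionI_sets)

lemma cheap_region_beta0:
  assumes N: "0 < N"
  shows "cheap_region N beta0 \<in> lmeasurable"
    and "measure lebesgue (cheap_region N beta0) = N\<^sup>2 * (((beta0 - 2)\<^sup>2 - 2) / (beta0 * (beta0 - 2)))"
    and "set_integrable lebesgue (cheap_region N beta0) endpoint_cost"
    and "(LINT p:cheap_region N beta0|lebesgue. endpoint_cost p) = 2 * N"
proof -
  note vals = cheap_region_values[OF N beta0_solution]
  note sub = cheap_region_subset[OF N beta0_solution(1)]
  have a: "0 < N / (beta0 - 1)" using N beta0_solution(1) by simp
  show "cheap_region N beta0 \<in> lmeasurable"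
    by (rule fmeasurableI2[OF box_lmeasurable sub cheap_region_sets])
  have "measure lborel (cheap_region N beta0) = integral\<^sup>L lborel (\<lambda>p. indicator (cheap_region N beta0) p * 1)"
    by simp
  also have "\<dots> = N\<^sup>2 * (((beta0 - 2)\<^sup>2 - 2) / (beta0 * (beta0 - 2)))"
    by (rule has_bochner_integral_integral_eq[OF vals(1)])
  finally show "measure lebesgue (cheap_region N beta0) = N\<^sup>2 * (((beta0 - 2)\<^sup>2 - 2) / (beta0 * (beta0 - 2)))"
    by simp
  show "set_integrable lebesgue (cheap_region N beta0) endpoint_cost"
    by (rule symmetric_cost(1)[OF cheap_region_sets sub cheap_region_swap a])
  have "(LINT p:cheap_region N beta0|lebesgue. 1 / fst p)
      = integral\<^sup>L lborel (\<lambda>p. indicator (cheap_region N beta0) p * (1 / fst p))"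
    unfolding set_lebesgue_integral_def real_scaleR_def
    by (rule integral_completion) (rule borel_measurable_has_bochner_integral[OF vals(2)])
  also have "\<dots> = N" by (rule has_bochner_integral_integral_eq[OF vals(2)])
  finally show "(LINT p:cheap_region N beta0|lebesgue. endpoint_cost p) = 2 * N"
    using symmetric_cost(2)[OF cheap_region_sets sub cheap_region_swap a] by simp
qed

text \<open>
For \<open>n \<le> 4\<close> the comparison set sticks out of \<open>[1, n]\<^sup>2\<close> and is not feasible, but the bathtub principle
only asks that it contain the cheap points of \<open>A\<close>.
\<close>
lemma feasible_measure_le:
  assumes n: "1 \<le> n" and A: "relaxation_feasible n A"
  shows "measure lebesgue A \<le> (real n)\<^sup>2 * (((beta0 - 2)\<^sup>2 - 2) / (beta0 * (beta0 - 2)))"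
proof -
  have N: "0 < real n" using n by simp
  have "measure lebesgue A \<le> measure lebesgue (cheap_region (real n) beta0)"
  proof (rule bathtub[where w = endpoint_cost and c = "beta0 / real n"])
    show "x \<in> cheap_region (real n) beta0" if "x \<in> A" "endpoint_cost x \<le> beta0 / real n" for x
      using relaxation_feasibleD(2)[OF A] that by (auto simp: cheap_region_def square_def)
    show "(LINT p:A|lebesgue. endpoint_cost p) \<le> (LINT p:cheap_region (real n) beta0|lebesgue. endpoint_cost p)"
      using relaxation_feasibleD(4)[OF A] cheap_region_beta0(4)[OF N] by simp
    show "0 < beta0 / real n" using beta0_solution(1) N by simp
    show "endpoint_cost x \<le> beta0 / real n" if "x \<in> cheap_region (real n) beta0" for x
      using that by (simp add: cheap_region_def)
  qed (use A relaxation_feasibleD cheap_region_beta0[OF N] in auto)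
  then show ?thesis by (simp add: cheap_region_beta0(2)[OF N])
qed

text \<open>
Here \<open>n \<ge> 5\<close> enters: \<open>\<beta>\<^sub>0 - 1 < 5\<close>, so that the corner \<open>n / (\<beta>\<^sub>0 - 1)\<close> of the region is at least 1.
\<close>
lemma cheap_region_eq_threshold:
  assumes n: "5 \<le> n"
  shows "cheap_region (real n) beta0 = threshold_region n (beta0 / real n)"
proof
  have N: "0 < real n" using n by simp
  have "1 \<le> real n / (beta0 - 1)" using n beta0_solution beta0_bounds by (simp add: field_simps)
  then show "cheap_region (real n) beta0 \<subseteq> threshold_region n (beta0 / real n)"
    using cheap_region_subset[OF N beta0_solution(1)]
    by (fastforce simp: cheap_region_def threshold_region_def square_def)
  show "threshold_region n (beta0 / real n) \<subseteq> cheap_region (real n) beta0"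
    by (auto simp: cheap_region_def threshold_region_def square_def)
qed

section \<open>Comparing lattice sums with integrals\<close>

text \<open>
The triangle and its mirror image cover the square and overlap in the diagonal.
\<close>
lemma sum_triangle_symmetric:
  fixes f :: "nat \<Rightarrow> nat \<Rightarrow> real"
  assumes sym: "\<And>i k. f i k = f k i" and I: "finite I"
  shows "2 * (\<Sum>(i, k)\<in>{(i, k). i \<in> I \<and> k \<in> I \<and> i \<le> k}. f i k)
       = (\<Sum>(i, k)\<in>I \<times> I. f i k) + (\<Sum>i\<in>I. f i i)"
proof -
  define T where "T = {(i, k). i \<in> I \<and> k \<in> I \<and> i \<le> k}"
  have "T \<subseteq> I \<times> I" by (auto simp: T_def)
  then have finT: "finite T" using I by (meson finite_SigmaI finite_subset)
  have swap: "(\<Sum>(i, k)\<in>prod.swap ` T. f i k) = (\<Sum>(i, k)\<in>T. f i k)"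
    by (subst sum.reindex) (auto intro!: sum.cong sym)
  have un: "T \<union> prod.swap ` T = I \<times> I"
    by (auto simp: T_def image_iff)
  have int: "T \<inter> prod.swap ` T = (\<lambda>i. (i, i)) ` I"
    by (auto simp: T_def image_iff)
  have "(\<Sum>(i, k)\<in>I \<times> I. f i k) + (\<Sum>(i, k)\<in>(\<lambda>i. (i, i)) ` I. f i k)
      = (\<Sum>(i, k)\<in>T. f i k) + (\<Sum>(i, k)\<in>prod.swap ` T. f i k)"
    unfolding un[symmetric] int[symmetric] using finT by (intro sum.union_inter) auto
  moreover have "(\<Sum>(i, k)\<in>(\<lambda>i. (i, i)) ` I. f i k) = (\<Sum>i\<in>I. f i i)"
    by (subst sum.reindex) (auto simp: inj_on_def)
  ultimately show ?thesis unfolding T_def[symmetric] using swap by linarith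
qed

text \<open>
Attach to each lattice point \<open>(i, k)\<close> the unit cell with that point as its lower left corner. The
function \<open>max 0 (c - endpoint_cost)\<close> increases in both variables, so its value at the corner is at most its
integral over the cell; the cells are disjoint subsets of the square.
\<close>
lemma lattice_sum_le_surplus:
  "(\<Sum>(i, k)\<in>{1..<n} \<times> {1..<n}. max 0 (c - (1 / real i + 1 / real k)))
    \<le> c * measure lebesgue (threshold_region n c) - (LINT p:threshold_region n c|lebesgue. endpoint_cost p)"
proof -
  define \<phi> where "\<phi> i k = max 0 (c - (1 / real i + 1 / real k))" for i k
  define cell where "cell i k = {real i..<real i + 1} \<times> {real k..<real k + 1}" for i k
  let ?T = "threshold_region n c"
  have cell: "cell i k \<in> lmeasurable" "measure lebesgue (cell i k) = 1" for i k
  proof -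
    have 1: "cell i k \<in> sets lborel"
      unfolding cell_def sets_lborel borel_prod[symmetric] by (intro pair_measureI) auto
    have "emeasure lborel (cell i k) = emeasure lborel {real i..<real i + 1} * emeasure lborel {real k..<real k + 1}"
      unfolding cell_def lborel_prod[symmetric] by (rule lborel.emeasure_pair_measure_Times) auto
    then have 2: "emeasure lborel (cell i k) = 1" by simp
    then have "emeasure lebesgue (cell i k) = 1" using 1 by simp
    then show "cell i k \<in> lmeasurable" "measure lebesgue (cell i k) = 1"
      using 1 by (auto simp: fmeasurable_def sets_completionI_sets measure_def)
  qed
  have Tm: "?T \<in> lmeasurable"
    by (rule fmeasurableI2[OF square_properties(1) threshold_region_sets(2,1)])
  have Tcost: "set_integrable lebesgue ?T endpoint_cost"
    by (rule set_integrable_subset[OF square_properties(4) threshold_region_sets])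
  have Tc: "set_integrable lebesgue ?T (\<lambda>_. c)"
    unfolding set_integrable_def using Tm by (auto simp: fmeasurable_def)
  have cells: "integrable lebesgue (\<lambda>p. \<phi> (fst ik) (snd ik) * indicator (cell (fst ik) (snd ik)) p)" for ik
    using cell(1)[of "fst ik" "snd ik"]
    by (intro integrable_mult_right) (auto simp: fmeasurable_def intro!: integrable_real_indicator)
  have "(\<Sum>(i, k)\<in>{1..<n} \<times> {1..<n}. \<phi> i k)
      = (\<Sum>ik\<in>{1..<n} \<times> {1..<n}. \<integral>p. \<phi> (fst ik) (snd ik) * indicator (cell (fst ik) (snd ik)) p \<partial>lebesgue)"
    using cell by (intro sum.cong) (auto simp: fmeasurable_def)
  also have "\<dots> = (\<integral>p. (\<Sum>ik\<in>{1..<n} \<times> {1..<n}. \<phi> (fst ik) (snd ik) * indicator (cell (fst ik) (snd ik)) p) \<partial>lebesgue)"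
    using cells by (intro Bochner_Integration.integral_sum[symmetric]) auto
  also have "\<dots> \<le> (LINT p:?T|lebesgue. c - endpoint_cost p)"
    unfolding set_lebesgue_integral_def
  proof (rule integral_mono)
    show "integrable lebesgue (\<lambda>p. \<Sum>ik\<in>{1..<n} \<times> {1..<n}. \<phi> (fst ik) (snd ik) * indicator (cell (fst ik) (snd ik)) p)"
      using cells by (intro Bochner_Integration.integrable_sum) auto
    show "integrable lebesgue (\<lambda>p. indicator ?T p *\<^sub>R (c - endpoint_cost p))"
      using set_integral_diff(1)[OF Tc Tcost] by (simp add: set_integrable_def)
    fix p :: "real \<times> real"
    \<comment> \<open>The only cell that can contain \<open>p\<close>.\<close>
    define j where "j = (nat \<lfloor>fst p\<rfloor>, nat \<lfloor>snd p\<rfloor>)"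
    have floor: "nat \<lfloor>x\<rfloor> = i" if "real i \<le> x" "x < real i + 1" for i :: nat and x :: real
      using floor_unique[of "int i" x] that by simp
    have only: "ik = j" if "p \<in> cell (fst ik) (snd ik)" for ik
      using that floor[of "fst ik" "fst p"] floor[of "snd ik" "snd p"]
      by (simp add: cell_def j_def mem_Times_iff prod_eq_iff)
    have rhs: "0 \<le> indicator ?T p *\<^sub>R (c - endpoint_cost p)"
      by (auto simp: threshold_region_def indicator_def)
    have "(\<Sum>ik\<in>{1..<n} \<times> {1..<n}. \<phi> (fst ik) (snd ik) * indicator (cell (fst ik) (snd ik)) p)
        = (\<Sum>ik\<in>{1..<n} \<times> {1..<n}. if ik = j then \<phi> (fst j) (snd j) * indicator (cell (fst j) (snd j)) p else 0)"
      using only by (intro sum.cong) (auto simp: indicator_def)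
    also have "\<dots> = (if j \<in> {1..<n} \<times> {1..<n} then \<phi> (fst j) (snd j) * indicator (cell (fst j) (snd j)) p else 0)"
      by (simp add: sum.delta)
    also have "\<dots> \<le> indicator ?T p *\<^sub>R (c - endpoint_cost p)"
    proof (cases "j \<in> {1..<n} \<times> {1..<n} \<and> p \<in> cell (fst j) (snd j)")
      case True
      obtain i k where ik: "j = (i, k)" by fastforce
      have ik': "1 \<le> i" "i < n" "1 \<le> k" "k < n" using True ik by auto
      have p: "real i \<le> fst p" "fst p < real i + 1" "real k \<le> snd p" "snd p < real k + 1"
        using True by (auto simp: ik cell_def mem_Times_iff)
      have "1 / fst p \<le> 1 / real i" "1 / snd p \<le> 1 / real k"
        using p ik' by (auto intro!: divide_left_mono mult_pos_pos)
      then have cost: "endpoint_cost p \<le> 1 / real i + 1 / real k" by (simp add: endpoint_cost_def)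
      have "p \<in> square n"
        using p ik' by (auto simp: square_def mem_Times_iff)
      then have "\<phi> i k \<le> indicator ?T p *\<^sub>R (c - endpoint_cost p)"
        using cost by (auto simp: \<phi>_def threshold_region_def indicator_def)
      then show ?thesis using True by (simp add: ik)
    next
      case False
      then show ?thesis using rhs by (auto simp: indicator_def)
    qed
    finally show "(\<Sum>ik\<in>{1..<n} \<times> {1..<n}. \<phi> (fst ik) (snd ik) * indicator (cell (fst ik) (snd ik)) p)
        \<le> indicator ?T p *\<^sub>R (c - endpoint_cost p)" .
  qed
  also have "\<dots> = c * measure lebesgue ?T - (LINT p:?T|lebesgue. endpoint_cost p)"
    using Tm by (simp add: set_integral_diff(2)[OF Tc Tcost])
      (simp add: set_lebesgue_integral_def fmeasurable_def)
  finally show ?thesis by (simp only: \<phi>_def)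
qed

text \<open>
The right-hand side is \<open>\<integral> (c - 2 / x) dx\<close> from \<open>2 / c\<close> to \<open>n\<close>, and the sum is a lower Riemann sum of the
positive part. The antiderivative \<open>G\<close> in the proof is made constant to the left of \<open>2 / c\<close>, so that
its increments dominate the summands everywhere and the sum telescopes.
\<close>
lemma positive_part_sum_le:
  fixes c :: real
  assumes c: "0 < c" "c \<le> 2" and n: "1 \<le> n" "2 \<le> c * real n"
  shows "(\<Sum>i = 1..<n. max 0 (c - 2 / real i)) \<le> c * real n - 2 - 2 * ln (c * real n / 2)"
proof -
  define G where "G x = c * max x (2 / c) - 2 * ln (max x (2 / c))" for x
  have step: "max 0 (c - 2 / x) \<le> G (x + 1) - G x" if x: "1 \<le> x" for x
  proof -
    \<comment> \<open>Concavity of \<open>ln\<close>: the graph lies below its tangent at \<open>u\<close>.\<close>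
    have tangent: "2 * (ln v - ln u) \<le> 2 / u * (v - u)" if "0 < u" "0 < v" for u v :: real
    proof -
      have "ln v - ln u = ln (v / u)" using that by (simp add: ln_div)
      also have "\<dots> \<le> v / u - 1" using that by (intro ln_le_minus_one) simp
      finally show ?thesis using that by (simp add: field_simps)
    qed
    have pos: "0 < 2 / c" using c by simp
    have G0: "0 \<le> G (x + 1) - G x"
    proof -
      define u where "u = max x (2 / c)"
      define v where "v = max (x + 1) (2 / c)"
      have uv: "2 / c \<le> u" "u \<le> v" "0 < u" "0 < v" using pos by (use x in \<open>auto simp: u_def v_def less_max_iff_disj\<close>)
      have "2 / u \<le> c" using uv c by (simp add: field_simps)
      then have "2 / u * (v - u) \<le> c * (v - u)" using uv by (intro mult_right_mono) auto
      then show ?thesis using tangent[OF uv(3,4)]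
        unfolding G_def u_def[symmetric] v_def[symmetric] by (simp add: algebra_simps)
    qed
    show ?thesis
    proof (cases "2 / c \<le> x")
      case True
      then have "G (x + 1) - G x = c - 2 * (ln (x + 1) - ln x)" by (simp add: G_def algebra_simps)
      then show ?thesis using tangent[of x "x + 1"] x G0 by simp
    next
      case False
      then have "c - 2 / x < 0" using x c by (simp add: field_simps)
      then show ?thesis using G0 by simp
    qed
  qed
  have "(\<Sum>i = 1..<n. max 0 (c - 2 / real i)) \<le> (\<Sum>i = 1..<n. G (real (Suc i)) - G (real i))"
  proof (rule sum_mono)
    fix i assume "i \<in> {1..<n}"
    then show "max 0 (c - 2 / real i) \<le> G (real (Suc i)) - G (real i)"
      using step[of "real i"] by (simp add: add.commute)
  qed
  also have "\<dots> = G (real n) - G 1"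
    using n(1) by (subst sum_Suc_diff') auto
  also have "G 1 = 2 - 2 * ln (2 / c)"
    using c by (simp add: G_def max_def)
  also have "G (real n) = c * real n - 2 * ln (real n)"
    using c n by (simp add: G_def max_def field_simps)
  also have "c * real n - 2 * ln (real n) - (2 - 2 * ln (2 / c)) = c * real n - 2 - 2 * ln (c * real n / 2)"
    using c n by (simp add: ln_mult_pos ln_div)
  finally show ?thesis .
qed

text \<open>
For \<open>c = \<beta>\<^sub>0 / n\<close> the preceding bound becomes \<open>\<beta>\<^sub>0 - 2 - 2 ln (\<beta>\<^sub>0 / 2)\<close>, which is free of \<open>n\<close>. As \<open>\<beta>\<^sub>0 / 2 > e\<close>, it is at
most \<open>\<beta>\<^sub>0 - 4 < 2\<close>.
\<close>
lemma diagonal_beta0: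
  assumes "5 \<le> n"
  shows "(\<Sum>i = 1..<n. max 0 (beta0 / real n - 2 / real i)) \<le> 2 * real n / (real n - 1)"
proof -
  have "exp 1 \<le> beta0 / 2" using e_less_272 beta0_bounds by simp
  then have "1 \<le> ln (beta0 / 2)" using beta0_solution(1) by (subst ln_ge_iff) auto
  have "(\<Sum>i = 1..<n. max 0 (beta0 / real n - 2 / real i))
      \<le> beta0 / real n * real n - 2 - 2 * ln (beta0 / real n * real n / 2)"
  proof (rule positive_part_sum_le)
    show "beta0 / real n \<le> 2" using assms beta0_bounds by (simp add: field_simps)
  qed (use assms beta0_solution(1) in auto)
  also have "\<dots> = beta0 - 2 - 2 * ln (beta0 / 2)" using assms by simp
  also have "\<dots> \<le> 2" using \<open>1 \<le> ln (beta0 / 2)\<close> beta0_bounds by simp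
  also have "\<dots> \<le> 2 * real n / (real n - 1)" using assms by (simp add: field_simps)
  finally show ?thesis .
qed

text \<open>
For \<open>n = 4\<close> and \<open>c = 2\<close> the sum is \<open>0 + 1 + 4 / 3\<close>, against the allowance \<open>8 / 3\<close>.
\<close>
lemma diagonal_small:
  assumes "2 \<le> n" "n \<le> 4" "c \<le> 2"
  shows "(\<Sum>i = 1..<n. max 0 (c - 2 / real i)) \<le> 2 * real n / (real n - 1)"
proof -
  consider "n = 2" | "n = 3" | "n = 4" using assms by linarith
  then show ?thesis
    using assms(3) by cases (simp_all add: numeral_eq_Suc max_def)
qed

section \<open>The density of the joint degree vector\<close>

lemma jdv_support_subset:
  "jdv_support V E \<subseteq> {(i, k). i \<in> {1..<card V} \<and> k \<in> {1..<card V} \<and> i \<le> k}"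
  by (auto simp: jdv_support_def)

lemma card_triangle:
  "2 * card {(i, k). i \<in> {1..<n} \<and> k \<in> {1..<n} \<and> i \<le> k} = n * (n - 1)"
proof -
  let ?T = "{(i, k). i \<in> {1..<n} \<and> k \<in> {1..<n} \<and> i \<le> k}"
  have "2 * (\<Sum>(i :: nat, k :: nat)\<in>?T. 1 :: real) = real (card ({1..<n} \<times> {1..<n}) + card {1..<n})"
    by (subst sum_triangle_symmetric) auto
  then have "real (2 * card ?T) = real (n * (n - 1))"
    by (simp add: case_prod_unfold algebra_simps) (cases n; simp add: algebra_simps)
  then show ?thesis by linarith
qed

text \<open>
The duality argument, with the level \<open>c\<close> as multiplier. The factor \<open>n / (n - 1)\<close> between the two
normalisations is spent on the diagonal, using that \<open>c\<close> times the area is at least the cost \<open>2 n\<close>.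
\<close>
lemma jdv_support_density_le_threshold:
  assumes G: "simple_graph V E" and V: "card V = n" and n: "2 \<le> n" and c: "0 < c"
    and diag: "(\<Sum>i = 1..<n. max 0 (c - 2 / real i)) \<le> 2 * real n / (real n - 1)"
    and tight: "(LINT p:threshold_region n c|lebesgue. endpoint_cost p) = 2 * real n"
  shows "real (card (jdv_support V E)) / real (n choose 2)
    \<le> measure lebesgue (threshold_region n c) / (real n - 1)\<^sup>2"
proof -
  define m where "m = measure lebesgue (threshold_region n c)"
  define \<phi> where "\<phi> i k = max 0 (c - (1 / real i + 1 / real k))" for i k
  define T where "T = {(i, k). i \<in> {1..<n} \<and> k \<in> {1..<n} \<and> i \<le> k}"
  let ?A = "jdv_support V E"
  have AT: "?A \<subseteq> T" using jdv_support_subset[of V E] V by (simp add: T_def)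
  have "T \<subseteq> {1..<n} \<times> {1..<n}" by (auto simp: T_def)
  then have finT: "finite T" by (rule finite_subset) simp
  have "c * real (card ?A) = (\<Sum>(i, k)\<in>?A. c - (1 / real i + 1 / real k))
      + (\<Sum>(i, k)\<in>?A. 1 / real i + 1 / real k)"
    by (simp add: sum.distrib[symmetric] case_prod_unfold)
  also have "(\<Sum>(i, k)\<in>?A. 1 / real i + 1 / real k) \<le> real n"
    using sum_endpoint_weights_le_card[OF G] V by simp
  also have "(\<Sum>(i, k)\<in>?A. c - (1 / real i + 1 / real k)) \<le> (\<Sum>(i, k)\<in>?A. \<phi> i k)"
    by (intro sum_mono) (auto simp: \<phi>_def)
  also have "\<dots> \<le> (\<Sum>(i, k)\<in>T. \<phi> i k)"
    using AT finT by (intro sum_mono2) (auto simp: \<phi>_def)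
  finally have "2 * (c * real (card ?A)) \<le> 2 * (\<Sum>(i, k)\<in>T. \<phi> i k) + 2 * real n" by simp
  also have "2 * (\<Sum>(i, k)\<in>T. \<phi> i k) = (\<Sum>(i, k)\<in>{1..<n} \<times> {1..<n}. \<phi> i k) + (\<Sum>i = 1..<n. \<phi> i i)"
    unfolding T_def by (rule sum_triangle_symmetric) (auto simp: \<phi>_def add.commute)
  also have "(\<Sum>(i, k)\<in>{1..<n} \<times> {1..<n}. \<phi> i k) \<le> c * m - 2 * real n"
    using lattice_sum_le_surplus[of c n] tight by (simp add: \<phi>_def m_def)
  also have "(\<Sum>i = 1..<n. \<phi> i i) \<le> 2 * real n / (real n - 1)"
    using diag by (simp add: \<phi>_def)
  \<comment> \<open>The diagonal excess \<open>2 n / (n - 1)\<close> will be absorbed by \<open>c m / (n - 1)\<close>.\<close>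
  finally have 1: "2 * (c * real (card ?A)) \<le> c * m + 2 * real n / (real n - 1)" by simp
  have "0 \<le> (\<Sum>(i, k)\<in>{1..<n} \<times> {1..<n}. \<phi> i k)" by (intro sum_nonneg) (auto simp: \<phi>_def)
  then have "2 * real n \<le> c * m"
    using lattice_sum_le_surplus[of c n] tight by (simp add: \<phi>_def m_def)
  then have "2 * real n / (real n - 1) \<le> c * m / (real n - 1)"
    using n by (intro divide_right_mono) auto
  with 1 have "2 * (c * real (card ?A)) \<le> c * m + c * m / (real n - 1)" by linarith
  also have "\<dots> = c * (m * real n / (real n - 1))" using n by (simp add: field_simps)
  finally have "c * (2 * real (card ?A)) \<le> c * (m * real n / (real n - 1))" by simp
  then have "2 * real (card ?A) \<le> m * real n / (real n - 1)"
    using c by (simp only: mult_le_cancel_left_pos)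
  then have "2 * real (card ?A) / (real n * (real n - 1)) \<le> m * real n / (real n - 1) / (real n * (real n - 1))"
    using n by (intro divide_right_mono) auto
  also have "\<dots> = m / (real n - 1)\<^sup>2" using n by (simp add: power2_eq_square)
  also have "2 * real (card ?A) / (real n * (real n - 1)) = real (card ?A) / real (n choose 2)"
    using n by (simp add: choose_two real_of_nat_div of_nat_diff)
  finally show ?thesis by (simp only: m_def)
qed

lemma relaxation_maximum:
  assumes n: "2 \<le> n" and A: "relaxation_feasible n A"
    and max: "\<And>B. relaxation_feasible n B \<Longrightarrow> measure lebesgue B \<le> measure lebesgue A"
  shows "alpha_relax n = measure lebesgue A / (real n - 1)\<^sup>2"
    and "alpha_relax n \<in> relaxation_values n"
    and "\<And>r. r \<in> relaxation_values n \<Longrightarrow> r \<le> alpha_relax n"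
proof -
  have mem: "measure lebesgue A / (real n - 1)\<^sup>2 \<in> relaxation_values n"
    using A by (auto simp: relaxation_values_def)
  have ub: "r \<le> measure lebesgue A / (real n - 1)\<^sup>2" if "r \<in> relaxation_values n" for r
    using that max by (auto simp: relaxation_values_def intro!: divide_right_mono)
  show eq: "alpha_relax n = measure lebesgue A / (real n - 1)\<^sup>2"
    unfolding alpha_relax_def using mem ub by (rule Greatest_equality)
  show "alpha_relax n \<in> relaxation_values n" using mem by (simp add: eq)
  show "r \<le> alpha_relax n" if "r \<in> relaxation_values n" for r using ub[OF that] by (simp add: eq)
qed

text \<open>
The optimal level is only known to be at most 2, which suffices for the diagonal. If the whole square
is feasible then the maximum is 1, which is a trivial bound for the graph.
\<close>
lemma relaxation_maximizer_small:
  assumes n: "2 \<le> n" "n \<le> 4"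
  obtains A where "relaxation_feasible n A"
    "\<And>B. relaxation_feasible n B \<Longrightarrow> measure lebesgue B \<le> measure lebesgue A"
    "\<And>(V :: 'a set) E. simple_graph V E \<Longrightarrow> card V = n \<Longrightarrow>
      real (card (jdv_support V E)) / real (n choose 2) \<le> measure lebesgue A / (real n - 1)\<^sup>2"
proof -
  consider "relaxation_feasible n (square n)"
    | c where "0 < c" "c \<le> 2" "(LINT p:threshold_region n c|lebesgue. endpoint_cost p) = 2 * real n"
    using square_feasible_or_tight_threshold[of n] n by auto
  then show ?thesis
  proof cases
    case 1
    show ?thesis
    proof (rule that[OF 1])
      show "measure lebesgue B \<le> measure lebesgue (square n)" if "relaxation_feasible n B" for B
        using relaxation_feasibleD[OF that] square_properties by (intro measure_mono_fmeasurable) auto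
      fix V :: "'a set" and E
      assume "simple_graph V E" and V: "card V = n"
      have "jdv_support V E \<subseteq> {(i, k). i \<in> {1..<n} \<and> k \<in> {1..<n} \<and> i \<le> k}"
        using jdv_support_subset[of V E] V by simp
      moreover have "finite {(i, k). i \<in> {1..<n} \<and> k \<in> {1..<n} \<and> i \<le> k}"
        by (rule finite_subset[of _ "{1..<n} \<times> {1..<n}"]) auto
      ultimately have "card (jdv_support V E) \<le> n choose 2"
        using card_mono[of "{(i, k). i \<in> {1..<n} \<and> k \<in> {1..<n} \<and> i \<le> k}" "jdv_support V E"] card_triangle[of n]
        by (simp add: choose_two)
      then show "real (card (jdv_support V E)) / real (n choose 2) \<le> measure lebesgue (square n) / (real n - 1)\<^sup>2"
        using n by (subst measure_square) (auto simp: divide_le_eq_1)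
    qed
  next
    case 2
    show ?thesis
      using tight_threshold_optimal[OF 2(3,1)]
        jdv_support_density_le_threshold[OF _ _ n(1) 2(1) diagonal_small[OF n 2(2)] 2(3)]
      by (rule that)
  qed
qed

theorem theorem1:
  shows "(\<exists>!\<beta>::real. \<beta> > 2 \<and> ln (\<beta> - 1) = \<beta> / (\<beta> - 2)) \<and>
    \<bar>beta0 - 5.68050\<bar> < 5 / 10 ^ 6 \<and>
    \<bar>((beta0 - 2)\<^sup>2 - 2) / (beta0 * (beta0 - 2)) - 0.55225694\<bar> < 2 / 10 ^ 7 \<and>
    (\<forall>n::nat. n \<ge> 2 \<longrightarrow>
       alpha_relax n \<in> relaxation_values n \<and>
       (\<forall>r\<in>relaxation_values n. r \<le> alpha_relax n) \<and>
       (\<forall>(V :: 'a set) (E :: 'a set set).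
          simple_graph V E \<and> no_isolated_vertices V E \<and> card V = n \<longrightarrow>
          real (card (jdv_support V E)) / real (n choose 2) \<le> alpha_relax n) \<and>
       alpha_relax n \<le> (real n)\<^sup>2 / (real n - 1)\<^sup>2 *
         (((beta0 - 2)\<^sup>2 - 2) / (beta0 * (beta0 - 2))) \<and>
       (n \<ge> 5 \<longrightarrow>
          alpha_relax n = (real n)\<^sup>2 / (real n - 1)\<^sup>2 *
            (((beta0 - 2)\<^sup>2 - 2) / (beta0 * (beta0 - 2)))))"
proof (intro conjI allI impI)
  fix n :: nat
  assume n: "2 \<le> n"
  let ?\<gamma> = "((beta0 - 2)\<^sup>2 - 2) / (beta0 * (beta0 - 2))"
  obtain A where A: "relaxation_feasible n A"
      "\<And>B. relaxation_feasible n B \<Longrightarrow> measure lebesgue B \<le> measure lebesgue A"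
      "\<And>(V :: 'a set) E. simple_graph V E \<Longrightarrow> card V = n \<Longrightarrow>
        real (card (jdv_support V E)) / real (n choose 2) \<le> measure lebesgue A / (real n - 1)\<^sup>2"
      "5 \<le> n \<longrightarrow> measure lebesgue A = (real n)\<^sup>2 * ?\<gamma>"
  proof (cases "5 \<le> n")
    case True
    then have N: "0 < real n" by simp
    note region = cheap_region_eq_threshold[OF True]
    have c: "0 < beta0 / real n" using N beta0_solution(1) by simp
    have tight: "(LINT p:threshold_region n (beta0 / real n)|lebesgue. endpoint_cost p) = 2 * real n"
      using cheap_region_beta0(4)[OF N] by (simp add: region)
    show ?thesis
      using tight_threshold_optimal[OF tight c]
        jdv_support_density_le_threshold[OF _ _ n c diagonal_beta0[OF True] tight]
        impI[OF cheap_region_beta0(2)[OF N, unfolded region]]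
      by (rule that)
  next
    case False
    with n obtain A where "relaxation_feasible n A"
      "\<And>B. relaxation_feasible n B \<Longrightarrow> measure lebesgue B \<le> measure lebesgue A"
      "\<And>(V :: 'a set) E. simple_graph V E \<Longrightarrow> card V = n \<Longrightarrow>
        real (card (jdv_support V E)) / real (n choose 2) \<le> measure lebesgue A / (real n - 1)\<^sup>2"
      using relaxation_maximizer_small[of n, where 'a = 'a] by auto
    then show ?thesis using False by (intro that) auto
  qed
  note max = relaxation_maximum[OF n A(1,2)]
  show "alpha_relax n \<in> relaxation_values n" by (rule max)
  show "\<forall>r\<in>relaxation_values n. r \<le> alpha_relax n" using max(3) by blast
  show "real (card (jdv_support V E)) / real (n choose 2) \<le> alpha_relax n"
    if "simple_graph V E \<and> no_isolated_vertices V E \<and> card V = n" for V :: "'a set" and E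
    using A(3)[of V E] that by (simp add: max(1) mult_ac)
  have "measure lebesgue A / (real n - 1)\<^sup>2 \<le> (real n)\<^sup>2 * ?\<gamma> / (real n - 1)\<^sup>2"
    by (intro divide_right_mono feasible_measure_le[OF _ A(1)]) (use n in auto)
  then show "alpha_relax n \<le> (real n)\<^sup>2 / (real n - 1)\<^sup>2 * ?\<gamma>" by (simp add: max(1) mult_ac)
  show "alpha_relax n = (real n)\<^sup>2 / (real n - 1)\<^sup>2 * ?\<gamma>" if "5 \<le> n"
    using A(4) that by (simp add: max(1) mult_ac)
qed (rule beta_ex1 beta0_approx density_bound)+

end
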